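(* For any continuous maps $X \xrightarrow{f} Z \xleftarrow{g} Y$ and any multiplicative cohomology theory $H^*$, one has $$\mathrm{l.c.p.}(I_{f,g})\ \le\ \mathrm{TC}(f,g).$$
   Context: Let $\Delta_Z\colon Z\to Z\times Z$ be the diagonal map, $I_Z:=\mathrm{Ker}(\Delta_Z^* )\subseteq H^*(Z\times Z)$, and $I_{f,g}:=(f\times g)^*(I_Z)\subseteq H^*(X\times Y)$, the image of $I_Z$ under the homomorphism induced by $f\times g\colon X\times Y\to Z\times Z$. For a subset $S\subseteq H^*(X\times Y)$, $\mathrm{l.c.p.}(S)$ (length of the cup product) is the least integer $k$ such that every product $u_0\smile\cdots\smile u_k$ of $k+1$ elements of $S$ is zero in $H^*(X\times Y)$ ($\infty$ if there is none). All maps are continuous, $I=[0,1]$, and path spaces $X^I$ carry the compact-open topology. For a map $p\colon E\to B$, the sectional number $\mathrm{sec}(p)$ is the least integer $k\ge 0$ such that $B$ has an open cover $U_0,\dots,U_k$ with continuous maps $s_i\colon U_i\to E$ satisfying $p\circ s_i=\mathrm{inc}_{U_i}$ (strict equality); $\mathrm{sec}(p)=\infty$ if no such $k$ exists. Put $\Delta^I_{f,g}=\{(\alpha,\beta)\in X^I\times Y^I : f\circ\alpha=g\circ\beta\}$ and $\pi_{f,g}\colon\Delta^I_{f,g}\to X\times Y$, $\pi_{f,g}(\alpha,\beta)=(\alpha(0),\beta(1))$. The bivariate topological complexity is $\mathrm{TC}(f,g):=\mathrm{sec}(\pi_{f,g})$. *)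

theory Defs
  imports "HOL-Analysis.Analysis" "HOL-Algebra.AbelCoset" "HOL-Library.Equipollence"
    "HOL-Library.Extended_Nat"
begin

definition mapping_space :: "'a topology \<Rightarrow> 'b topology \<Rightarrow> ('a \<Rightarrow> 'b) set" where
  "mapping_space X Y = {\<alpha> \<in> extensional (topspace X). continuous_map X Y \<alpha>}"

definition compact_open_topology :: "'a topology \<Rightarrow> 'b topology \<Rightarrow> ('a \<Rightarrow> 'b) topology" where
  "compact_open_topology X Y =
     topology_generated_by
       {{\<alpha> \<in> mapping_space X Y. \<alpha> ` K \<subseteq> V} | K V. compactin X K \<and> openin Y V}"

definition path_space :: "'a topology \<Rightarrow> (real \<Rightarrow> 'a) topology" where
  "path_space X = compact_open_topology (top_of_set {0..1}) X"

definition path_pullback ::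
    "'x topology \<Rightarrow> 'y topology \<Rightarrow> ('x \<Rightarrow> 'z) \<Rightarrow> ('y \<Rightarrow> 'z) \<Rightarrow> ((real \<Rightarrow> 'x) \<times> (real \<Rightarrow> 'y)) topology"
  where
  "path_pullback X Y f g =
     subtopology (prod_topology (path_space X) (path_space Y))
       {(\<alpha>, \<beta>). \<forall>t\<in>{0..1}. f (\<alpha> t) = g (\<beta> t)}"

definition endpoint_map :: "(real \<Rightarrow> 'x) \<times> (real \<Rightarrow> 'y) \<Rightarrow> 'x \<times> 'y" where
  "endpoint_map = (\<lambda>(\<alpha>, \<beta>). (\<alpha> 0, \<beta> 1))"

text \<open>In \<^typ>\<open>enat\<close> the infimum of the empty set is \<open>\<infinity>\<close>, and any other infimum is attained.\<close>

definition sectional_number :: "'e topology \<Rightarrow> 'b topology \<Rightarrow> ('e \<Rightarrow> 'b) \<Rightarrow> enat" where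
  "sectional_number E B p =
     Inf {enat k | k. \<exists>(U :: nat \<Rightarrow> 'b set) (s :: nat \<Rightarrow> 'b \<Rightarrow> 'e).
            (\<forall>i\<le>k. openin B (U i)) \<and> (\<Union>i\<le>k. U i) = topspace B \<and>
            (\<forall>i\<le>k. continuous_map (subtopology B (U i)) E (s i) \<and> (\<forall>b\<in>U i. p (s i b) = b))}"

definition bivariate_TC ::
    "'x topology \<Rightarrow> 'y topology \<Rightarrow> ('x \<Rightarrow> 'z) \<Rightarrow> ('y \<Rightarrow> 'z) \<Rightarrow> enat" where
  "bivariate_TC X Y f g =
     sectional_number (path_pullback X Y f g) (prod_topology X Y) endpoint_map"

text \<open>
  Cohomology theories on all pairs of spaces with points in a type \<open>'u\<close>.
  As in HOL-Homology, abelian groups are commutative groups in multiplicative notation,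
  and the functions of a record are only constrained on genuine pairs of spaces and on
  elements of the carriers.
  \<open>pull H n X A Y B f\<close> is the map from \<open>H\<^sup>n(Y,B)\<close> to \<open>H\<^sup>n(X,A)\<close> induced by \<open>f : (X,A) \<rightarrow> (Y,B)\<close>,
  and \<open>cobd H n X A\<close> is the coboundary from \<open>H\<^sup>n(A)\<close> to \<open>H\<^sup>n\<^sup>+\<^sup>1(X,A)\<close>.
\<close>

record ('u, 'c) cohomology =
  coh  :: "int \<Rightarrow> 'u topology \<Rightarrow> 'u set \<Rightarrow> 'c monoid"
  pull :: "int \<Rightarrow> 'u topology \<Rightarrow> 'u set \<Rightarrow> 'u topology \<Rightarrow> 'u set \<Rightarrow> ('u \<Rightarrow> 'u) \<Rightarrow> 'c \<Rightarrow> 'c"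
  cobd :: "int \<Rightarrow> 'u topology \<Rightarrow> 'u set \<Rightarrow> 'c \<Rightarrow> 'c"

definition pair_map :: "'a topology \<Rightarrow> 'a set \<Rightarrow> 'b topology \<Rightarrow> 'b set \<Rightarrow> ('a \<Rightarrow> 'b) \<Rightarrow> bool" where
  "pair_map X A Y B f \<longleftrightarrow>
     A \<subseteq> topspace X \<and> B \<subseteq> topspace Y \<and> continuous_map X Y f \<and> f ` A \<subseteq> B"

text \<open>
  The Eilenberg--Steenrod axioms without the dimension axiom. Since \<^const>\<open>homotopic_with\<close>
  relates any two continuous maps that agree on the domain space, \<open>homotopy\<close> also says that
  the values of a map outside its domain are irrelevant.
\<close>

locale cohomology_theory =
  fixes H :: "('u, 'c, 'm) cohomology_scheme"
  assumes coh_group: "A \<subseteq> topspace X \<Longrightarrow> comm_group (coh H n X A)"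
    and pull_hom: "pair_map X A Y B f \<Longrightarrow> pull H n X A Y B f \<in> hom (coh H n Y B) (coh H n X A)"
    and pull_id: "\<lbrakk>A \<subseteq> topspace X; x \<in> carrier (coh H n X A)\<rbrakk> \<Longrightarrow> pull H n X A X A id x = x"
    and pull_comp:
      "\<lbrakk>pair_map X A Y B f; pair_map Y B W C g; x \<in> carrier (coh H n W C)\<rbrakk>
       \<Longrightarrow> pull H n X A W C (g \<circ> f) x = pull H n X A Y B f (pull H n Y B W C g x)"
    and cobd_hom:
      "A \<subseteq> topspace X
       \<Longrightarrow> cobd H n X A \<in> hom (coh H n (subtopology X A) {}) (coh H (n + 1) X A)"
    and cobd_natural:
      "\<lbrakk>pair_map X A Y B f; x \<in> carrier (coh H n (subtopology Y B) {})\<rbrakk>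
       \<Longrightarrow> cobd H n X A (pull H n (subtopology X A) {} (subtopology Y B) {} f x)
           = pull H (n + 1) X A Y B f (cobd H n Y B x)"
    and homotopy:
      "\<lbrakk>pair_map X A Y B f; pair_map X A Y B g; homotopic_with (\<lambda>h. h ` A \<subseteq> B) X Y f g;
        x \<in> carrier (coh H n Y B)\<rbrakk>
       \<Longrightarrow> pull H n X A Y B f x = pull H n X A Y B g x"
    and exact_absolute:
      "A \<subseteq> topspace X
       \<Longrightarrow> pull H n X {} X A id ` carrier (coh H n X A)
           = kernel (coh H n X {}) (coh H n (subtopology X A) {})
               (pull H n (subtopology X A) {} X {} id)"
    and exact_subspace:
      "A \<subseteq> topspace X
       \<Longrightarrow> pull H n (subtopology X A) {} X {} id ` carrier (coh H n X {})
           = kernel (coh H n (subtopology X A) {}) (coh H (n + 1) X A) (cobd H n X A)"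
    and exact_relative:
      "A \<subseteq> topspace X
       \<Longrightarrow> cobd H n X A ` carrier (coh H n (subtopology X A) {})
           = kernel (coh H (n + 1) X A) (coh H (n + 1) X {}) (pull H (n + 1) X {} X A id)"
    and excision:
      "\<lbrakk>U \<subseteq> A; A \<subseteq> topspace X; X closure_of U \<subseteq> X interior_of A\<rbrakk>
       \<Longrightarrow> pull H n (subtopology X (topspace X - U)) (A - U) X A id
           \<in> iso (coh H n X A) (coh H n (subtopology X (topspace X - U)) (A - U))"

text \<open>
  \<open>cup H m n X A B\<close> is the product \<open>H\<^sup>m(X,A) \<times> H\<^sup>n(X,B) \<rightarrow> H\<^sup>m\<^sup>+\<^sup>n(X,A \<union> B)\<close>. It is required for
  couples that are open in their union; by excision these are excisive in every theory, and they
  include \<open>(A,{})\<close>, \<open>({},A)\<close> and \<open>(A,A)\<close>. Graded commutativity is not imposed.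
\<close>

record ('u, 'c) multiplicative_cohomology = "('u, 'c) cohomology" +
  cup :: "int \<Rightarrow> int \<Rightarrow> 'u topology \<Rightarrow> 'u set \<Rightarrow> 'u set \<Rightarrow> 'c \<Rightarrow> 'c \<Rightarrow> 'c"
  unit_elt :: "'u topology \<Rightarrow> 'c"

definition open_couple :: "'a topology \<Rightarrow> 'a set \<Rightarrow> 'a set \<Rightarrow> bool" where
  "open_couple X A B \<longleftrightarrow>
     A \<subseteq> topspace X \<and> B \<subseteq> topspace X \<and>
     openin (subtopology X (A \<union> B)) A \<and> openin (subtopology X (A \<union> B)) B"

text \<open>
  In the two stability axioms \<open>w\<close> is the class that corresponds to a product under the excision
  isomorphism \<open>H(A \<union> B, B) \<cong> H(A, A \<inter> B)\<close> (resp. \<open>H(A \<union> B, A) \<cong> H(B, A \<inter> B)\<close>), so that the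
  right-hand sides are its image under the coboundary of the triple \<open>(X, A \<union> B, B)\<close>
  (resp. \<open>(X, A \<union> B, A)\<close>).
\<close>

locale multiplicative_cohomology_theory = cohomology_theory H
  for H :: "('u, 'c, 'm) multiplicative_cohomology_scheme" +
  assumes cup_closed:
      "\<lbrakk>open_couple X A B; x \<in> carrier (coh H m X A); y \<in> carrier (coh H n X B)\<rbrakk>
       \<Longrightarrow> cup H m n X A B x y \<in> carrier (coh H (m + n) X (A \<union> B))"
    and cup_add_left:
      "\<lbrakk>open_couple X A B; x \<in> carrier (coh H m X A); x' \<in> carrier (coh H m X A);
        y \<in> carrier (coh H n X B)\<rbrakk>
       \<Longrightarrow> cup H m n X A B (x \<otimes>\<^bsub>coh H m X A\<^esub> x') y
           = cup H m n X A B x y \<otimes>\<^bsub>coh H (m + n) X (A \<union> B)\<^esub> cup H m n X A B x' y"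
    and cup_add_right:
      "\<lbrakk>open_couple X A B; x \<in> carrier (coh H m X A);
        y \<in> carrier (coh H n X B); y' \<in> carrier (coh H n X B)\<rbrakk>
       \<Longrightarrow> cup H m n X A B x (y \<otimes>\<^bsub>coh H n X B\<^esub> y')
           = cup H m n X A B x y \<otimes>\<^bsub>coh H (m + n) X (A \<union> B)\<^esub> cup H m n X A B x y'"
    and cup_natural:
      "\<lbrakk>open_couple X A B; open_couple Y C D; pair_map X A Y C f; pair_map X B Y D f;
        x \<in> carrier (coh H m Y C); y \<in> carrier (coh H n Y D)\<rbrakk>
       \<Longrightarrow> pull H (m + n) X (A \<union> B) Y (C \<union> D) f (cup H m n Y C D x y)
           = cup H m n X A B (pull H m X A Y C f x) (pull H n X B Y D f y)"
    and cup_assoc: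
      "\<lbrakk>open_couple X A (B \<union> C); open_couple X B (A \<union> C); open_couple X C (A \<union> B);
        x \<in> carrier (coh H m X A); y \<in> carrier (coh H n X B); z \<in> carrier (coh H k X C)\<rbrakk>
       \<Longrightarrow> cup H (m + n) k X (A \<union> B) C (cup H m n X A B x y) z
           = cup H m (n + k) X A (B \<union> C) x (cup H n k X B C y z)"
    and unit_closed: "unit_elt H X \<in> carrier (coh H 0 X {})"
    and unit_natural:
      "continuous_map X Y f \<Longrightarrow> pull H 0 X {} Y {} f (unit_elt H Y) = unit_elt H X"
    and cup_unit_left:
      "\<lbrakk>A \<subseteq> topspace X; x \<in> carrier (coh H n X A)\<rbrakk> \<Longrightarrow> cup H 0 n X {} A (unit_elt H X) x = x"
    and cup_unit_right:
      "\<lbrakk>A \<subseteq> topspace X; x \<in> carrier (coh H n X A)\<rbrakk> \<Longrightarrow> cup H n 0 X A {} x (unit_elt H X) = x"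
    and cup_stable_left:
      "\<lbrakk>open_couple X A B; x \<in> carrier (coh H m (subtopology X A) {}); y \<in> carrier (coh H n X B);
        w \<in> carrier (coh H (m + n) (subtopology X (A \<union> B)) B);
        pull H (m + n) (subtopology X A) (A \<inter> B) (subtopology X (A \<union> B)) B id w
          = cup H m n (subtopology X A) {} (A \<inter> B) x
              (pull H n (subtopology X A) (A \<inter> B) X B id y)\<rbrakk>
       \<Longrightarrow> cup H (m + 1) n X A B (cobd H m X A x) y
           = cobd H (m + n) X (A \<union> B)
               (pull H (m + n) (subtopology X (A \<union> B)) {} (subtopology X (A \<union> B)) B id w)"
    and cup_stable_right:
      "\<lbrakk>open_couple X A B; x \<in> carrier (coh H m X A); y \<in> carrier (coh H n (subtopology X B) {});
        w \<in> carrier (coh H (m + n) (subtopology X (A \<union> B)) A);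
        pull H (m + n) (subtopology X B) (A \<inter> B) (subtopology X (A \<union> B)) A id w
          = cup H m n (subtopology X B) (A \<inter> B) {}
              (pull H m (subtopology X B) (A \<inter> B) X A id x) y;
        v = cobd H (m + n) X (A \<union> B)
              (pull H (m + n) (subtopology X (A \<union> B)) {} (subtopology X (A \<union> B)) A id w)\<rbrakk>
       \<Longrightarrow> cup H m (n + 1) X A B x (cobd H n X B y)
           = (if even m then v else inv\<^bsub>coh H (m + n + 1) X (A \<union> B)\<^esub> v)"

text \<open>
  The ring \<open>H\<^sup>*(X)\<close> is the direct sum of the groups \<open>H\<^sup>n(X)\<close>; its elements are the finitely
  supported families of classes. The family \<open>total_pull H X Y f\<close> is the induced map from
  \<open>H\<^sup>*(Y)\<close> to \<open>H\<^sup>*(X)\<close>.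
\<close>

definition total_ring ::
    "('u, 'c, 'm) multiplicative_cohomology_scheme \<Rightarrow> 'u topology \<Rightarrow> (int \<Rightarrow> 'c) ring" where
  "total_ring H X =
     \<lparr>carrier = {u. (\<forall>n. u n \<in> carrier (coh H n X {})) \<and> finite {n. u n \<noteq> \<one>\<^bsub>coh H n X {}\<^esub>}},
      mult = (\<lambda>u v n. finprod (coh H n X {}) (\<lambda>i. cup H i (n - i) X {} {} (u i) (v (n - i)))
                        {i. u i \<noteq> \<one>\<^bsub>coh H i X {}\<^esub>}),
      one = (\<lambda>n. if n = 0 then unit_elt H X else \<one>\<^bsub>coh H n X {}\<^esub>),
      zero = (\<lambda>n. \<one>\<^bsub>coh H n X {}\<^esub>),
      add = (\<lambda>u v n. u n \<otimes>\<^bsub>coh H n X {}\<^esub> v n)\<rparr>"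

definition total_pull ::
    "('u, 'c, 'm) cohomology_scheme \<Rightarrow> 'u topology \<Rightarrow> 'u topology \<Rightarrow> ('u \<Rightarrow> 'u)
      \<Rightarrow> (int \<Rightarrow> 'c) \<Rightarrow> (int \<Rightarrow> 'c)" where
  "total_pull H X Y f = (\<lambda>u n. pull H n X {} Y {} f (u n))"

text \<open>
  A theory on spaces with points in \<open>'u\<close> is evaluated on a space \<open>W\<close> over another type by
  replacing \<open>W\<close> with a homeomorphic copy over \<open>'u\<close>. Such a copy exists precisely when
  \<open>topspace W \<lesssim> (UNIV :: 'u set)\<close>; nothing depends on its choice, by functoriality.
\<close>

definition copy_map :: "'w topology \<Rightarrow> 'w \<Rightarrow> 'u" where
  "copy_map W = (SOME e. inj_on e (topspace W))"

definition copy_inv :: "'w topology \<Rightarrow> 'u \<Rightarrow> 'w" where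
  "copy_inv W = inv_into (topspace W) (copy_map W)"

definition copy_space :: "'w topology \<Rightarrow> 'u topology" where
  "copy_space W = pullback_topology (copy_map W ` topspace W) (copy_inv W) W"

definition cohomology_ring ::
    "('u, 'c, 'm) multiplicative_cohomology_scheme \<Rightarrow> 'w topology \<Rightarrow> (int \<Rightarrow> 'c) ring" where
  "cohomology_ring H W = total_ring H (copy_space W)"

definition induced_map ::
    "('u, 'c, 'm) cohomology_scheme \<Rightarrow> 'v topology \<Rightarrow> 'w topology \<Rightarrow> ('v \<Rightarrow> 'w)
      \<Rightarrow> (int \<Rightarrow> 'c) \<Rightarrow> (int \<Rightarrow> 'c)" where
  "induced_map H V W h =
     total_pull H (copy_space V) (copy_space W) (copy_map W \<circ> h \<circ> copy_inv V)"

definition diagonal_ideal ::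
    "('u, 'c, 'm) multiplicative_cohomology_scheme \<Rightarrow> 'z topology \<Rightarrow> (int \<Rightarrow> 'c) set" where
  "diagonal_ideal H Z =
     a_kernel (cohomology_ring H (prod_topology Z Z)) (cohomology_ring H Z)
       (induced_map H Z (prod_topology Z Z) (\<lambda>z. (z, z)))"

definition bivariate_ideal ::
    "('u, 'c, 'm) multiplicative_cohomology_scheme \<Rightarrow> 'x topology \<Rightarrow> 'y topology \<Rightarrow> 'z topology
      \<Rightarrow> ('x \<Rightarrow> 'z) \<Rightarrow> ('y \<Rightarrow> 'z) \<Rightarrow> (int \<Rightarrow> 'c) set" where
  "bivariate_ideal H X Y Z f g =
     induced_map H (prod_topology X Y) (prod_topology Z Z) (map_prod f g) ` diagonal_ideal H Z"

definition length_of_cup_product :: "('r, 'n) ring_scheme \<Rightarrow> 'r set \<Rightarrow> enat" where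
  "length_of_cup_product R S =
     Inf {enat k | k. \<forall>us. length us = Suc k \<and> set us \<subseteq> S \<longrightarrow> foldr (mult R) us \<one>\<^bsub>R\<^esub> = \<zero>\<^bsub>R\<^esub>}"

end

theory Submission
  imports Defs
begin

text \<open>
  Let \<open>U\<close> be an open subset of \<open>X \<times> Y\<close> over which the endpoint map has a section
  \<open>(x, y) \<mapsto> (\<alpha>, \<beta>)\<close>. Then \<open>((x, y), t) \<mapsto> (f (\<alpha> t), g y)\<close> is a homotopy on \<open>U\<close> from \<open>f \<times> g\<close>
  to \<open>(x, y) \<mapsto> (g y, g y)\<close>, because \<open>f (\<alpha> 1) = g (\<beta> 1) = g y\<close>; it is continuous since
  \<open>[0,1]\<close> is locally compact. Thus \<open>f \<times> g\<close> factors on \<open>U\<close> through the diagonal of \<open>Z\<close> up to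
  homotopy, and every class of \<open>I\<^bsub>f,g\<^esub>\<close> restricts to zero on \<open>U\<close> (lemma
  \<open>bivariate_ideal_subset_vanishing_classes\<close>).

  By exactness a class on \<open>W\<close> that vanishes on an open set \<open>A\<close> comes from \<open>H\<^sup>*(W, A)\<close>. The relative
  cup product therefore shows that the product of a class vanishing on \<open>A\<close> and a class vanishing on
  \<open>B\<close> comes from \<open>H\<^sup>*(W, A \<union> B)\<close>, so it vanishes on \<open>A \<union> B\<close> (lemma \<open>mult_vanishing_classes\<close>). If
  \<open>U\<^sub>0, \<dots>, U\<^sub>k\<close> is an open cover as in the definition of \<open>TC(f,g)\<close>, then a product of \<open>k + 1\<close>
  elements of \<open>I\<^bsub>f,g\<^esub>\<close> vanishes on \<open>U\<^sub>0 \<union> \<dots> \<union> U\<^sub>k = X \<times> Y\<close>.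
\<close>

section \<open>Evaluation on a compact-open topology\<close>

lemma topspace_compact_open_topology:
  "topspace (compact_open_topology T X) \<subseteq> mapping_space T X"
  by (auto simp: compact_open_topology_def topology_generated_by_topspace)

text \<open>One direction of the exponential law: a continuous family of maps has a continuous adjoint
  if the source of the maps is locally compact and Hausdorff.\<close>

lemma continuous_map_uncurry_compact_open:
  assumes T: "locally_compact_space T" "Hausdorff_space T"
    and s: "continuous_map U (compact_open_topology T X) s"
  shows "continuous_map (prod_topology T U) X (\<lambda>(t, b). s b t)"
proof -
  have s_cont: "continuous_map T X (s b)" if "b \<in> topspace U" for b
    using continuous_map_image_subset_topspace[OF s] topspace_compact_open_topology[of T X] that
    by (auto simp: mapping_space_def)
  have nbhd: "\<exists>N. openin (prod_topology T U) N \<and> (t, b) \<in> N \<and> N \<subseteq> {p \<in> topspace T \<times> topspace U.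
          (case p of (t, b) \<Rightarrow> s b t) \<in> V}"
    if V: "openin X V" and t: "t \<in> topspace T" and b: "b \<in> topspace U" and stb: "s b t \<in> V"
    for V t b
  proof -
    have "neighbourhood_base_of (compactin T) T"
      using T locally_compact_space_neighbourhood_base by blast
    moreover have "openin T {t \<in> topspace T. s b t \<in> V}"
      using openin_continuous_map_preimage[OF s_cont[OF b] V] .
    ultimately obtain O' K where O': "openin T O'" "compactin T K" "t \<in> O'" "O' \<subseteq> K"
        "K \<subseteq> {t \<in> topspace T. s b t \<in> V}"
      using t stb unfolding neighbourhood_base_of
      by (elim allE[of _ "{t \<in> topspace T. s b t \<in> V}"] allE[of _ t]) auto
    \<comment> \<open>The subbasic neighbourhood of \<open>s b\<close> given by a compact neighbourhood \<open>K\<close> of \<open>t\<close>.\<close>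
    define M where "M = {\<alpha> \<in> mapping_space T X. \<alpha> ` K \<subseteq> V}"
    have "openin (compact_open_topology T X) M"
      unfolding compact_open_topology_def M_def
      by (rule topology_generated_by_Basis) (use O'(2) V in blast)
    then have "openin U {b \<in> topspace U. s b \<in> M}"
      using openin_continuous_map_preimage[OF s] by blast
    moreover have "s b \<in> mapping_space T X"
      using continuous_map_image_subset_topspace[OF s] topspace_compact_open_topology[of T X] b
      by blast
    then have "b \<in> {b \<in> topspace U. s b \<in> M}"
      using O'(5) b by (auto simp: M_def)
    ultimately have N: "openin (prod_topology T U) (O' \<times> {b \<in> topspace U. s b \<in> M})"
        "(t, b) \<in> O' \<times> {b \<in> topspace U. s b \<in> M}"
      using O'(1,3) by (simp_all add: openin_prod_Times_iff)
    have sub: "O' \<times> {b \<in> topspace U. s b \<in> M} \<subseteq> {p \<in> topspace T \<times> topspace U.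
        (case p of (t, b) \<Rightarrow> s b t) \<in> V}"
    proof (rule subsetI, elim SigmaE CollectE conjE, hypsubst)
      fix t' b'
      assume "t' \<in> O'" "b' \<in> topspace U" "s b' \<in> M"
      then show "(t', b') \<in> {p \<in> topspace T \<times> topspace U. (case p of (t, b) \<Rightarrow> s b t) \<in> V}"
        using O'(4) openin_subset[OF O'(1)] by (auto simp: M_def image_subset_iff)
    qed
    show ?thesis
      by (rule exI[of _ "O' \<times> {b \<in> topspace U. s b \<in> M}"], intro conjI N sub)
  qed
  have "openin (prod_topology T U)
      {p \<in> topspace (prod_topology T U). (case p of (t, b) \<Rightarrow> s b t) \<in> V}" if "openin X V" for V
    unfolding topspace_prod_topology
  proof (subst openin_subopen, intro ballI, elim CollectE conjE SigmaE)
    fix p t b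
    assume "(case p of (t, b) \<Rightarrow> s b t) \<in> V" "t \<in> topspace T" "b \<in> topspace U" "p = (t, b)"
    then show "\<exists>N. openin (prod_topology T U) N \<and> p \<in> N \<and> N \<subseteq> {p \<in> topspace T \<times> topspace U.
          (case p of (t, b) \<Rightarrow> s b t) \<in> V}"
      using nbhd[OF that] by simp
  qed
  moreover have "s b t \<in> topspace X" if "t \<in> topspace T" "b \<in> topspace U" for t b
    using continuous_map_image_subset_topspace[OF s_cont[OF that(2)]] that by blast
  ultimately show ?thesis
    by (auto simp: continuous_map_def)
qed

lemma continuous_map_uncurry_path_space:
  assumes "continuous_map U (path_space X) s"
  shows "continuous_map (prod_topology (top_of_set {0..1}) U) X (\<lambda>(t, b). s b t)"
  using assms unfolding path_space_def
  by (intro continuous_map_uncurry_compact_open compact_imp_locally_compact_space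
        Hausdorff_space_subtopology Hausdorff_space_euclidean)
     (simp_all add: compact_space_subtopology)

section \<open>Sections of the endpoint map\<close>

lemma homotopic_map_prod_diagonal:
  assumes f: "continuous_map X Z f" and g: "continuous_map Y Z g"
    and s: "continuous_map (subtopology (prod_topology X Y) U) (path_pullback X Y f g) s"
    and U: "U \<subseteq> topspace (prod_topology X Y)"
    and sec: "\<forall>b\<in>U. endpoint_map (s b) = b"
  shows "homotopic_with (\<lambda>_. True) (subtopology (prod_topology X Y) U) (prod_topology Z Z)
           (map_prod f g) (\<lambda>p. (g (snd p), g (snd p)))"
proof -
  let ?U = "subtopology (prod_topology X Y) U"
  have topU: "topspace ?U = U"
    using U by auto
  have "continuous_map ?U (prod_topology (path_space X) (path_space Y)) s
      \<and> s \<in> topspace ?U \<rightarrow> {(\<alpha>, \<beta>). \<forall>t\<in>{0..1}. f (\<alpha> t) = g (\<beta> t)}"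
    using s unfolding path_pullback_def continuous_map_in_subtopology .
  then have sp: "continuous_map ?U (prod_topology (path_space X) (path_space Y)) s"
    and pb: "s \<in> U \<rightarrow> {(\<alpha>, \<beta>). \<forall>t\<in>{0..1}. f (\<alpha> t) = g (\<beta> t)}"
    unfolding topU by (rule conjunct1, rule conjunct2)
  have "continuous_map ?U (path_space X) (fst \<circ> s)"
    using sp continuous_map_compose continuous_map_fst by blast
  then have c1: "continuous_map (prod_topology (top_of_set {0..1}) ?U) X
      (\<lambda>(t, b). fst (s b) t)"
    using continuous_map_uncurry_path_space by fastforce
  have snd_cont: "continuous_map ?U Y snd"
    by (simp add: continuous_map_from_subtopology continuous_map_snd)
  have "continuous_map (prod_topology (top_of_set {0..1}) ?U) Z (f \<circ> (\<lambda>(t, b). fst (s b) t))"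
    using c1 f continuous_map_compose by blast
  moreover have "continuous_map (prod_topology (top_of_set {0..1}) ?U) Z (g \<circ> (snd \<circ> snd))"
    by (intro continuous_map_compose[OF _ g] continuous_map_compose[OF continuous_map_snd snd_cont])
  ultimately have h: "continuous_map (prod_topology (top_of_set {0..1}) ?U) (prod_topology Z Z)
      (\<lambda>(t, b). (f (fst (s b) t), g (snd b)))"
    by (simp add: continuous_map_pairwise o_def case_prod_unfold)
  \<comment> \<open>The first path is run from \<open>x\<close> to a point over \<open>g y\<close>; the second coordinate stays at \<open>g y\<close>.\<close>
  have start: "fst (s b) 0 = fst b" and snd_end: "snd (s b) 1 = snd b" if "b \<in> U" for b
    using bspec[OF sec that] by (simp_all add: endpoint_map_def case_prod_unfold prod_eq_iff)
  have finish: "f (fst (s b) 1) = g (snd b)" if "b \<in> U" for b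
  proof -
    have "f (fst (s b) 1) = g (snd (s b) 1)"
    proof -
      have "s b \<in> {(\<alpha>, \<beta>). \<forall>t\<in>{0..1}. f (\<alpha> t) = g (\<beta> t)}"
        using pb that by (rule funcset_mem)
      then show ?thesis
        by (simp add: case_prod_unfold)
    qed
    with snd_end[OF that] show ?thesis
      by simp
  qed
  show ?thesis
  proof (subst homotopic_with, simp, intro exI conjI ballI)
    show "continuous_map (prod_topology (top_of_set {0..1}) ?U) (prod_topology Z Z)
        (\<lambda>(t, b). (f (fst (s b) t), g (snd b)))"
      by (rule h)
  qed (simp_all only: topU, simp_all add: start finish map_prod_def case_prod_unfold)
qed

section \<open>Copies of spaces\<close>

lemma inj_on_copy_map:
  fixes W :: "'w topology"
  assumes "topspace W \<lesssim> (UNIV :: 'u set)"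
  shows "inj_on (copy_map W :: 'w \<Rightarrow> 'u) (topspace W)"
  unfolding copy_map_def
  by (rule someI_ex[where P = "\<lambda>e. inj_on e (topspace W)"]) (use assms in \<open>auto simp: lepoll_def\<close>)

lemma continuous_map_copy_inv: "continuous_map (copy_space W) W (copy_inv W)"
  unfolding copy_space_def
  using continuous_map_pullback[of W W id "copy_map W ` topspace W" "copy_inv W"] by simp

lemma topspace_copy_space: "topspace (copy_space W) = copy_map W ` topspace W"
  by (auto simp: copy_space_def topspace_pullback_topology copy_inv_def inv_into_into)

lemma copy_inv_copy_map:
  fixes W :: "'w topology"
  assumes "inj_on (copy_map W :: 'w \<Rightarrow> 'u) (topspace W)" "w \<in> topspace W"
  shows "copy_inv W (copy_map W w :: 'u) = w"
  using assms by (simp add: copy_inv_def)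

lemma continuous_map_copy_map:
  assumes "inj_on (copy_map W :: 'w \<Rightarrow> 'u) (topspace W)"
  shows "continuous_map W (copy_space W :: 'u topology) (copy_map W)"
  unfolding copy_space_def
proof (rule continuous_map_pullback')
  show "continuous_map W W (copy_inv W \<circ> (copy_map W :: 'w \<Rightarrow> 'u))"
    by (rule continuous_map_eq[OF continuous_map_id]) (use assms in \<open>simp add: copy_inv_copy_map\<close>)
qed blast

section \<open>Classes vanishing on a subspace\<close>

lemma pair_map_empty [simp]: "pair_map X {} Y {} h \<longleftrightarrow> continuous_map X Y h"
  by (simp add: pair_map_def)

lemma (in comm_group) finprod_in_subgroup:
  assumes "subgroup K G" "\<And>i. i \<in> I \<Longrightarrow> a i \<in> K"
  shows "finprod G a I \<in> K"
  using assms(2)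
proof (induction I rule: infinite_finite_induct)
  case (insert i I)
  then have "a \<in> insert i I \<rightarrow> carrier G"
    using subgroup.mem_carrier[OF assms(1)] by blast
  then show ?case
    using insert by (simp add: subgroup.m_closed[OF assms(1)] Pi_iff)
qed (simp_all add: subgroup.one_closed[OF assms(1)])

text \<open>The families of classes on \<open>W\<close> whose restriction to \<open>A\<close> is zero in every degree. Finite
  support is not required: each component of a product is a \<^const>\<open>finprod\<close>, which is the neutral
  element when its index set is infinite.\<close>

definition vanishing_classes ::
    "('u, 'c, 'm) cohomology_scheme \<Rightarrow> 'u topology \<Rightarrow> 'u set \<Rightarrow> (int \<Rightarrow> 'c) set" where
  "vanishing_classes H W A =
     {u. \<forall>n. u n \<in> kernel (coh H n W {}) (coh H n (subtopology W A) {})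
                      (pull H n (subtopology W A) {} W {} id)}"

context cohomology_theory
begin

lemma pull_one:
  assumes "continuous_map X Y h"
  shows "pull H n X {} Y {} h \<one>\<^bsub>coh H n Y {}\<^esub> = \<one>\<^bsub>coh H n X {}\<^esub>"
  using pull_hom[of X "{}" Y "{}" h n] coh_group[of "{}" X n] coh_group[of "{}" Y n] assms
  by (simp add: comm_group_def hom_one)

lemma subgroup_vanishing:
  "subgroup (kernel (coh H n W {}) (coh H n (subtopology W A) {})
     (pull H n (subtopology W A) {} W {} id)) (coh H n W {})"
proof -
  have "group_hom (coh H n W {}) (coh H n (subtopology W A) {})
      (pull H n (subtopology W A) {} W {} id)"
    using coh_group[of "{}" W n] coh_group[of "{}" "subtopology W A" n]
      pull_hom[of "subtopology W A" "{}" W "{}" id n]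
    by (simp add: group_hom_def group_hom_axioms_def comm_group_def
        continuous_map_from_subtopology)
  then show ?thesis
    by (rule group_hom.subgroup_kernel)
qed

text \<open>Exactness for the pair \<open>(\<emptyset>, \<emptyset>)\<close> shows that the cohomology of the empty space is trivial,
  so there is no condition when \<open>A\<close> is empty.\<close>

lemma vanishing_classes_empty:
  assumes "\<And>n. u n \<in> carrier (coh H n W {})"
  shows "u \<in> vanishing_classes H W {}"
proof -
  let ?E = "subtopology W {}"
  have triv: "x = \<one>\<^bsub>coh H n ?E {}\<^esub>" if "x \<in> carrier (coh H n ?E {})" for x n
  proof -
    have "pull H n ?E {} ?E {} id x = x"
      using that by (simp add: pull_id)
    moreover have "pull H n ?E {} ?E {} id x \<in> pull H n ?E {} ?E {} id ` carrier (coh H n ?E {})"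
      using that by blast
    moreover have "pull H n ?E {} ?E {} id ` carrier (coh H n ?E {})
        = kernel (coh H n ?E {}) (coh H n ?E {}) (pull H n ?E {} ?E {} id)"
      using exact_absolute[of "{}" ?E n] by (simp add: subtopology_subtopology)
    ultimately show ?thesis
      unfolding kernel_def by simp
  qed
  have "pull H n ?E {} W {} id \<in> hom (coh H n W {}) (coh H n ?E {})" for n
    by (rule pull_hom) (simp add: continuous_map_from_subtopology)
  then show ?thesis
    using assms triv by (auto simp: vanishing_classes_def kernel_def hom_def Pi_iff)
qed

lemma vanishing_classes_topspace:
  assumes "u \<in> vanishing_classes H W (topspace W)"
  shows "u n = \<one>\<^bsub>coh H n W {}\<^esub>"
proof -
  have "u n \<in> carrier (coh H n W {})" "pull H n W {} W {} id (u n) = \<one>\<^bsub>coh H n W {}\<^esub>"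
    using assms by (auto simp: vanishing_classes_def kernel_def)
  then show ?thesis
    by (simp add: pull_id)
qed

text \<open>If \<open>h\<close> factors on \<open>A\<close> through \<open>d\<close> up to homotopy, then \<open>h\<close> pulls the kernel of the map
  induced by \<open>d\<close> back to classes that vanish on \<open>A\<close>.\<close>

lemma vanishing_classes_factor:
  assumes h: "continuous_map W V h" and d: "continuous_map D V d"
    and q: "continuous_map (subtopology W A) D q"
    and hom: "homotopic_with (\<lambda>_. True) (subtopology W A) V h (d \<circ> q)"
    and v: "\<And>n. v n \<in> kernel (coh H n V {}) (coh H n D {}) (pull H n D {} V {} d)"
  shows "total_pull H W V h v \<in> vanishing_classes H W A"
proof -
  let ?A = "subtopology W A"
  have "pull H n W {} V {} h (v n) \<in> kernel (coh H n W {}) (coh H n ?A {}) (pull H n ?A {} W {} id)"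
    for n
  proof -
    have vn: "v n \<in> carrier (coh H n V {})" "pull H n D {} V {} d (v n) = \<one>\<^bsub>coh H n D {}\<^esub>"
      using v[of n] by (auto simp: kernel_def)
    have hA: "continuous_map ?A V h" and iA: "continuous_map ?A W id"
      using h by (simp_all add: continuous_map_from_subtopology)
    have "pull H n ?A {} W {} id (pull H n W {} V {} h (v n)) = pull H n ?A {} V {} (h \<circ> id) (v n)"
      using pull_comp[of ?A "{}" W "{}" id V "{}" h "v n" n] h iA vn(1) by simp
    also have "\<dots> = pull H n ?A {} V {} (d \<circ> q) (v n)"
      using homotopy[of ?A "{}" V "{}" h "d \<circ> q" "v n" n] hom hA
        continuous_map_compose[OF q d] vn(1) by simp
    also have "\<dots> = pull H n ?A {} D {} q (pull H n D {} V {} d (v n))"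
      using pull_comp[of ?A "{}" D "{}" q V "{}" d "v n" n] q d vn(1) by simp
    also have "\<dots> = \<one>\<^bsub>coh H n ?A {}\<^esub>"
      using vn(2) pull_one[OF q] by simp
    finally show ?thesis
      using pull_hom[of W "{}" V "{}" h n] h vn(1) by (auto simp: kernel_def hom_def)
  qed
  then show ?thesis
    by (simp add: vanishing_classes_def total_pull_def)
qed

end

context multiplicative_cohomology_theory
begin

text \<open>Both classes lift to relative classes, whose product in \<open>H\<^sup>m\<^sup>+\<^sup>n(W, A \<union> B)\<close> maps to the
  product of the two classes by naturality.\<close>

lemma cup_vanishing:
  assumes A: "openin W A" and B: "openin W B"
    and x: "x \<in> kernel (coh H m W {}) (coh H m (subtopology W A) {})
                  (pull H m (subtopology W A) {} W {} id)"
    and y: "y \<in> kernel (coh H n W {}) (coh H n (subtopology W B) {})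
                  (pull H n (subtopology W B) {} W {} id)"
  shows "cup H m n W {} {} x y
           \<in> kernel (coh H (m + n) W {}) (coh H (m + n) (subtopology W (A \<union> B)) {})
               (pull H (m + n) (subtopology W (A \<union> B)) {} W {} id)"
proof -
  have AB: "A \<subseteq> topspace W" "B \<subseteq> topspace W"
    using A B openin_subset by auto
  obtain x' where x': "x' \<in> carrier (coh H m W A)" "x = pull H m W {} W A id x'"
    using x exact_absolute[OF AB(1)] by blast
  obtain y' where y': "y' \<in> carrier (coh H n W B)" "y = pull H n W {} W B id y'"
    using y exact_absolute[OF AB(2)] by blast
  have oc: "open_couple W A B" "open_couple W {} {}"
    using A B AB openin_Un[OF A B] by (simp_all add: open_couple_def openin_open_subtopology)
  have "cup H m n W {} {} x y = pull H (m + n) W {} W (A \<union> B) id (cup H m n W A B x' y')"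
    using cup_natural[of W "{}" "{}" W A B id x' m y' n] oc AB x' y' by (simp add: pair_map_def)
  moreover have "cup H m n W A B x' y' \<in> carrier (coh H (m + n) W (A \<union> B))"
    using cup_closed oc(1) x'(1) y'(1) by blast
  ultimately show ?thesis
    using exact_absolute[of "A \<union> B" W "m + n"] AB by blast
qed

lemma mult_vanishing_classes:
  assumes "openin W A" "openin W B"
    and "u \<in> vanishing_classes H W A" "v \<in> vanishing_classes H W B"
  shows "u \<otimes>\<^bsub>total_ring H W\<^esub> v \<in> vanishing_classes H W (A \<union> B)"
proof -
  have "cup H i (n - i) W {} {} (u i) (v (n - i))
      \<in> kernel (coh H n W {}) (coh H n (subtopology W (A \<union> B)) {})
          (pull H n (subtopology W (A \<union> B)) {} W {} id)" for i n
    using cup_vanishing[OF assms(1,2), of "u i" i "v (n - i)" "n - i"] assms(3,4)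
    by (simp add: vanishing_classes_def)
  then show ?thesis
    unfolding vanishing_classes_def total_ring_def
    by (auto intro!: comm_group.finprod_in_subgroup coh_group subgroup_vanishing)
qed

text \<open>The unit at the end of the fold vanishes on the empty set, the union of no sets.\<close>

lemma foldr_mult_vanishing_classes:
  assumes "list_all2 (\<lambda>u A. openin W A \<and> u \<in> vanishing_classes H W A) us As"
  shows "foldr (mult (total_ring H W)) us \<one>\<^bsub>total_ring H W\<^esub> \<in> vanishing_classes H W (\<Union> (set As))
           \<and> openin W (\<Union> (set As))"
  using assms
proof (induction rule: list_all2_induct)
  case Nil
  have "\<one>\<^bsub>coh H n W {}\<^esub> \<in> carrier (coh H n W {})" for n
    using coh_group[of "{}" W n] by (simp add: comm_group_def group.is_monoid)
  then have "\<one>\<^bsub>total_ring H W\<^esub> n \<in> carrier (coh H n W {})" for n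
    by (simp add: total_ring_def unit_closed)
  then show ?case
    by (simp add: vanishing_classes_empty)
next
  case (Cons u us A As)
  then show ?case
    by (simp add: mult_vanishing_classes openin_Un)
qed

end

section \<open>The ideal of a pair of maps\<close>

text \<open>The homotopy and the factorisation are transported to the copies over \<open>'u\<close>. A copy of \<open>Z\<close>
  exists because the diagonal embeds \<open>Z\<close> into \<open>Z \<times> Z\<close>.\<close>

lemma bivariate_ideal_subset_vanishing_classes:
  fixes X :: "'x topology" and Y :: "'y topology" and Z :: "'z topology"
    and H :: "('u, 'c, 'm) multiplicative_cohomology_scheme"
  assumes H: "multiplicative_cohomology_theory H"
    and XY: "topspace (prod_topology X Y) \<lesssim> (UNIV :: 'u set)"
    and ZZ: "topspace (prod_topology Z Z) \<lesssim> (UNIV :: 'u set)"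
    and f: "continuous_map X Z f" and g: "continuous_map Y Z g"
    and s: "continuous_map (subtopology (prod_topology X Y) U) (path_pullback X Y f g) s"
    and U: "U \<subseteq> topspace (prod_topology X Y)"
    and sec: "\<forall>b\<in>U. endpoint_map (s b) = b"
  shows "bivariate_ideal H X Y Z f g
           \<subseteq> vanishing_classes H (copy_space (prod_topology X Y)) (copy_map (prod_topology X Y) ` U)"
proof
  interpret multiplicative_cohomology_theory H by fact
  let ?P = "prod_topology X Y" and ?Q = "prod_topology Z Z"
  let ?cP = "copy_map ?P :: _ \<Rightarrow> 'u" and ?cQ = "copy_map ?Q :: _ \<Rightarrow> 'u"
    and ?cZ = "copy_map Z :: _ \<Rightarrow> 'u"
  let ?iP = "copy_inv ?P :: 'u \<Rightarrow> _" and ?iZ = "copy_inv Z :: 'u \<Rightarrow> _"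
  let ?W = "copy_space ?P :: 'u topology" and ?A = "?cP ` U"
  have injP: "inj_on ?cP (topspace ?P)" and injQ: "inj_on ?cQ (topspace ?Q)"
    using XY ZZ by (simp_all only: inj_on_copy_map)
  have "topspace Z \<lesssim> topspace ?Q"
    unfolding lepoll_def by (intro exI[of _ "\<lambda>z. (z, z)"]) (auto intro: inj_onI)
  then have "topspace Z \<lesssim> (UNIV :: 'u set)"
    using ZZ by (rule lepoll_trans)
  then have injZ: "inj_on ?cZ (topspace Z)"
    by (rule inj_on_copy_map)
  have iP: "continuous_map (subtopology ?W ?A) (subtopology ?P U) ?iP"
  proof (rule continuous_map_into_subtopology)
    show "continuous_map (subtopology ?W ?A) ?P ?iP"
      by (intro continuous_map_from_subtopology continuous_map_copy_inv)
    have "?iP (?cP p) = p" if "p \<in> U" for p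
      using U that by (intro copy_inv_copy_map[OF injP]) blast
    then show "?iP \<in> topspace (subtopology ?W ?A) \<rightarrow> U"
      by auto
  qed
  have fg: "continuous_map ?P ?Q (map_prod f g)"
    using continuous_map_prod_top[of X Y Z Z f g] f g by (simp add: map_prod_def)
  have diag: "continuous_map Z ?Q (\<lambda>z. (z, z))"
    by (simp add: continuous_map_pairwise o_def)
  have gs: "continuous_map (subtopology ?P U) Z (g \<circ> snd)"
    by (intro continuous_map_compose[OF _ g] continuous_map_from_subtopology continuous_map_snd)
  have h: "continuous_map ?W (copy_space ?Q) (?cQ \<circ> map_prod f g \<circ> ?iP)"
    using continuous_map_copy_inv fg continuous_map_copy_map[OF injQ]
    by (intro continuous_map_compose) auto
  have d: "continuous_map (copy_space Z) (copy_space ?Q) (?cQ \<circ> (\<lambda>z. (z, z)) \<circ> ?iZ)"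
    using continuous_map_copy_inv diag continuous_map_copy_map[OF injQ]
    by (intro continuous_map_compose) auto
  have q: "continuous_map (subtopology ?W ?A) (copy_space Z) (?cZ \<circ> (g \<circ> snd) \<circ> ?iP)"
    by (rule continuous_map_compose[OF iP
          continuous_map_compose[OF gs continuous_map_copy_map[OF injZ]]])
  have "homotopic_with (\<lambda>_. True) (subtopology ?P U) ?Q (map_prod f g)
      (\<lambda>p. (g (snd p), g (snd p)))"
    using f g s U sec by (rule homotopic_map_prod_diagonal)
  then have "homotopic_with (\<lambda>_. True) (subtopology ?P U) (copy_space ?Q)
      (?cQ \<circ> map_prod f g) (?cQ \<circ> (\<lambda>p. (g (snd p), g (snd p))))"
    by (rule homotopic_with_compose_continuous_map_left)
       (use continuous_map_copy_map[OF injQ] in auto)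
  then have hom: "homotopic_with (\<lambda>_. True) (subtopology ?W ?A) (copy_space ?Q)
      (?cQ \<circ> map_prod f g \<circ> ?iP) (?cQ \<circ> (\<lambda>p. (g (snd p), g (snd p))) \<circ> ?iP)"
    by (rule homotopic_with_compose_continuous_map_right) (use iP in auto)
  have fac: "(?cQ \<circ> (\<lambda>p. (g (snd p), g (snd p))) \<circ> ?iP) w
      = (?cQ \<circ> (\<lambda>z. (z, z)) \<circ> ?iZ \<circ> (?cZ \<circ> (g \<circ> snd) \<circ> ?iP)) w"
    if "w \<in> topspace (subtopology ?W ?A)" for w
  proof -
    have "(g \<circ> snd) (?iP w) \<in> topspace Z"
      using that continuous_map_compose[OF iP gs] continuous_map_image_subset_topspace
      by fastforce
    then show ?thesis
      using copy_inv_copy_map[OF injZ] by simp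
  qed
  have hom': "homotopic_with (\<lambda>_. True) (subtopology ?W ?A) (copy_space ?Q)
      (?cQ \<circ> map_prod f g \<circ> ?iP)
      (?cQ \<circ> (\<lambda>z. (z, z)) \<circ> ?iZ \<circ> (?cZ \<circ> (g \<circ> snd) \<circ> ?iP))"
    by (rule homotopic_with_eq[OF hom]) (use fac in auto)
  fix u
  assume "u \<in> bivariate_ideal H X Y Z f g"
  then obtain v where v: "v \<in> diagonal_ideal H Z"
      "u = total_pull H ?W (copy_space ?Q) (?cQ \<circ> map_prod f g \<circ> ?iP) v"
    unfolding bivariate_ideal_def induced_map_def by blast
  have "v n \<in> kernel (coh H n (copy_space ?Q) {}) (coh H n (copy_space Z) {})
      (pull H n (copy_space Z) {} (copy_space ?Q) {} (?cQ \<circ> (\<lambda>z. (z, z)) \<circ> ?iZ))" for n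
    using v(1)
    by (auto simp: diagonal_ideal_def a_kernel_def kernel_def cohomology_ring_def total_ring_def
        induced_map_def total_pull_def fun_eq_iff)
  then show "u \<in> vanishing_classes H ?W ?A"
    unfolding v(2) by (rule vanishing_classes_factor[OF h d q hom'])
qed

theorem theorem3p1:
  fixes X :: "'x topology" and Y :: "'y topology" and Z :: "'z topology"
    and f :: "'x \<Rightarrow> 'z" and g :: "'y \<Rightarrow> 'z"
    and H :: "('u, 'c) multiplicative_cohomology"
  assumes "multiplicative_cohomology_theory H"
    and "topspace (prod_topology X Y) \<lesssim> (UNIV :: 'u set)"
    and "topspace (prod_topology Z Z) \<lesssim> (UNIV :: 'u set)"
    and "continuous_map X Z f"
    and "continuous_map Y Z g"
  shows "length_of_cup_product (cohomology_ring H (prod_topology X Y)) (bivariate_ideal H X Y Z f g)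
           \<le> bivariate_TC X Y f g"
proof -
  interpret multiplicative_cohomology_theory H by fact
  let ?P = "prod_topology X Y"
  let ?c = "copy_map ?P :: _ \<Rightarrow> 'u" and ?W = "copy_space ?P :: 'u topology"
  have inj: "inj_on ?c (topspace ?P)"
    using assms(2) by (rule inj_on_copy_map)
  have open_copy: "openin ?W (?c ` V)" if "openin ?P V" for V
  proof -
    have "?c ` V = {w \<in> topspace ?W. copy_inv ?P w \<in> V}"
      using openin_subset[OF that] copy_inv_copy_map[OF inj]
      by (fastforce simp: topspace_copy_space)
    then show ?thesis
      using openin_continuous_map_preimage[OF continuous_map_copy_inv that] by simp
  qed
  have zero: "foldr (mult (cohomology_ring H ?P)) us \<one>\<^bsub>cohomology_ring H ?P\<^esub>
      = \<zero>\<^bsub>cohomology_ring H ?P\<^esub>"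
    if U: "\<forall>i\<le>k. openin ?P (U i)" "(\<Union>i\<le>k. U i) = topspace ?P"
      and s: "\<forall>i\<le>k. continuous_map (subtopology ?P (U i)) (path_pullback X Y f g) (s i)
                \<and> (\<forall>b\<in>U i. endpoint_map (s i b) = b)"
      and us: "length us = Suc k" "set us \<subseteq> bivariate_ideal H X Y Z f g"
    for k U s and us :: "(int \<Rightarrow> 'c) list"
  proof -
    define As where "As = map (\<lambda>i. ?c ` U i) [0..<Suc k]"
    have "list_all2 (\<lambda>u A. openin ?W A \<and> u \<in> vanishing_classes H ?W A) us As"
    proof (rule list_all2_all_nthI)
      show "length us = length As"
        using us(1) by (simp add: As_def)
      fix i
      assume i: "i < length us"
      then have Ai: "As ! i = ?c ` U i" and ik: "i \<le> k"
        using us(1) by (auto simp: As_def simp del: upt_Suc)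
      have "bivariate_ideal H X Y Z f g \<subseteq> vanishing_classes H ?W (?c ` U i)"
        using U(1) s ik openin_subset
        by (intro bivariate_ideal_subset_vanishing_classes[OF assms, where s = "s i"]) blast+
      then show "openin ?W (As ! i) \<and> us ! i \<in> vanishing_classes H ?W (As ! i)"
        using open_copy U(1) ik us(2) nth_mem[OF i] by (auto simp: Ai)
    qed
    then have "foldr (mult (total_ring H ?W)) us \<one>\<^bsub>total_ring H ?W\<^esub>
        \<in> vanishing_classes H ?W (\<Union> (set As))"
      using foldr_mult_vanishing_classes by blast
    moreover have "set As = (\<lambda>i. ?c ` U i) ` {..k}"
      by (auto simp: As_def simp del: upt_Suc)
    then have "\<Union> (set As) = topspace ?W"
      using U(2) by (simp add: topspace_copy_space flip: image_UN)
    ultimately have "foldr (mult (total_ring H ?W)) us \<one>\<^bsub>total_ring H ?W\<^esub>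
        \<in> vanishing_classes H ?W (topspace ?W)"
      by simp
    then have "foldr (mult (total_ring H ?W)) us \<one>\<^bsub>total_ring H ?W\<^esub> n = \<one>\<^bsub>coh H n ?W {}\<^esub>" for n
      by (rule vanishing_classes_topspace)
    moreover have "\<zero>\<^bsub>total_ring H ?W\<^esub> = (\<lambda>n. \<one>\<^bsub>coh H n ?W {}\<^esub>)"
      by (simp add: total_ring_def)
    ultimately show ?thesis
      unfolding cohomology_ring_def by presburger
  qed
  show ?thesis
    unfolding length_of_cup_product_def bivariate_TC_def sectional_number_def
  proof (rule Inf_superset_mono, rule subsetI, elim CollectE exE conjE,
      intro CollectI exI conjI allI impI)
    fix e k U s and us :: "(int \<Rightarrow> 'c) list"
    assume "e = enat k" then show "e = enat k" .
    assume "\<forall>i\<le>k. openin ?P (U i)" "(\<Union>i\<le>k. U i) = topspace ?P"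
      "\<forall>i\<le>k. continuous_map (subtopology ?P (U i)) (path_pullback X Y f g) (s i)
          \<and> (\<forall>b\<in>U i. endpoint_map (s i b) = b)"
      "length us = Suc k \<and> set us \<subseteq> bivariate_ideal H X Y Z f g"
    then show "foldr (mult (cohomology_ring H ?P)) us \<one>\<^bsub>cohomology_ring H ?P\<^esub>
        = \<zero>\<^bsub>cohomology_ring H ?P\<^esub>"
      by (elim conjE) (rule zero)
  qed
qed

end
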